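(* Let $G=(V(G),E(G),r(G))$ be a simple rooted graph, let $r=r(G)$, let $L_r(G)=\{v\in V(G)\setminus\{r\}: rv\in E(G),\ d_G(v)=1\}$, and let $\ell_r(G)=|L_r(G)|$. Then $$\operatorname{ord}_{x}T(\Gamma(G);x,y)=\ell_r(G),$$ where $\operatorname{ord}_{x}T(\Gamma(G);x,y)=\max\{a\in\mathbb Z_{\geq0}:x^a\mid T(\Gamma(G);x,y)\}$, divisibility being in $\mathbb Z[x,y]$.
   Context: All graphs are finite. A simple graph has no loops and no multiple edges; it need not be connected. $d_G(v)$ is the degree of $v$ in $G$. A rooted graph $G=(V(G),E(G),r(G))$ is a graph with a distinguished vertex $r(G)$, called the root. For $A\subseteq E(G)$, let $G|A=(V(G),A,r(G))$ be the rooted spanning subgraph with edge set $A$, and let $C_G(A)$ be the connected component of $G|A$ containing $r(G)$. The set $A$ is feasible if $C_G(A)$ is a tree and contains all edges of $A$. Let $\mathcal F(G)$ be the family of feasible sets and $\Gamma(G)=(E(G),\mathcal F(G))$ the greedoid induced by $G$. Its rank function is $\rho_{\Gamma(G)}(A)=\max\{|A'|:A'\subseteq A,\ A'\in\mathcal F(G)\}$ and $\rho(\Gamma(G))=\rho_{\Gamma(G)}(E(G))$. The greedoid Tutte polynomial is $$T(\Gamma(G);x,y)=\sum_{A\subseteq E(G)}(x-1)^{\rho(\Gamma(G))-\rho_{\Gamma(G)}(A)}(y-1)^{|A|-\rho_{\Gamma(G)}(A)},$$ which is a nonzero polynomial in $\mathbb Z[x,y]$. *)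

theory Defs
  imports "HOL-Computational_Algebra.Polynomial"
begin

text \<open>An edge is the two-element set of its ends, so the absence of multiple edges is built into
  the encoding; \<open>simple_rooted_graph\<close> excludes loops.\<close>

record 'v rooted_graph =
  verts :: "'v set"
  edges :: "'v set set"
  rootv :: 'v

definition simple_rooted_graph :: "'v rooted_graph \<Rightarrow> bool" where
  "simple_rooted_graph G \<longleftrightarrow>
     finite (verts G) \<and> rootv G \<in> verts G \<and>
     edges G \<subseteq> {{u, v} | u v. u \<in> verts G \<and> v \<in> verts G \<and> u \<noteq> v}"

definition graph_deg :: "'v rooted_graph \<Rightarrow> 'v \<Rightarrow> nat" where
  "graph_deg G v = card {e \<in> edges G. v \<in> e}"

definition adj :: "'v rooted_graph \<Rightarrow> ('v \<times> 'v) set" where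
  "adj G = {(u, v). {u, v} \<in> edges G}"

definition connected_graph :: "'v rooted_graph \<Rightarrow> bool" where
  "connected_graph G \<longleftrightarrow>
     verts G \<noteq> {} \<and> (\<forall>u \<in> verts G. \<forall>v \<in> verts G. (u, v) \<in> (adj G)\<^sup>*)"

definition cycle :: "'v rooted_graph \<Rightarrow> 'v list \<Rightarrow> bool" where
  "cycle G vs \<longleftrightarrow>
     3 \<le> length vs \<and> distinct vs \<and>
     (\<forall>i < length vs. {vs ! i, vs ! (Suc i mod length vs)} \<in> edges G)"

definition is_tree :: "'v rooted_graph \<Rightarrow> bool" where
  "is_tree G \<longleftrightarrow> connected_graph G \<and> (\<nexists>vs. cycle G vs)"

text \<open>\<open>spanning_restrict G A\<close> is $G|A$.\<close>

definition spanning_restrict :: "'v rooted_graph \<Rightarrow> 'v set set \<Rightarrow> 'v rooted_graph" where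
  "spanning_restrict G A = G\<lparr>edges := A\<rparr>"

definition root_reach :: "'v rooted_graph \<Rightarrow> 'v set" where
  "root_reach G = {v \<in> verts G. (rootv G, v) \<in> (adj G)\<^sup>*}"

definition root_component :: "'v rooted_graph \<Rightarrow> 'v rooted_graph" where
  "root_component G =
     \<lparr>verts = root_reach G, edges = {e \<in> edges G. e \<subseteq> root_reach G}, rootv = rootv G\<rparr>"

text \<open>Here \<open>root_component (spanning_restrict G A)\<close> is $C_G(A)$.\<close>

definition feasible :: "'v rooted_graph \<Rightarrow> 'v set set \<Rightarrow> bool" where
  "feasible G A \<longleftrightarrow>
     A \<subseteq> edges G \<and>
     is_tree (root_component (spanning_restrict G A)) \<and>
     A \<subseteq> edges (root_component (spanning_restrict G A))"

text \<open>A greedoid is represented by the pair of its ground set and its family of feasible sets;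
  the greedoid axioms are not part of the type.\<close>

type_synonym 'e set_system = "'e set \<times> 'e set set"

definition graph_greedoid :: "'v rooted_graph \<Rightarrow> 'v set set_system" where
  "graph_greedoid G = (edges G, {A. feasible G A})"

definition greedoid_rank :: "'e set_system \<Rightarrow> 'e set \<Rightarrow> nat" where
  "greedoid_rank \<Gamma> A = Max {card A' | A'. A' \<subseteq> A \<and> A' \<in> snd \<Gamma>}"

text \<open>$\<int>[x,y]$ is realised as $\<int>[y][x]$: the outer indeterminate is $x$ and the inner one is $y$.\<close>

type_synonym int_poly_xy = "int poly poly"

definition var_x :: int_poly_xy where "var_x = [:0, 1:]"

definition var_y :: int_poly_xy where "var_y = [:[:0, 1:]:]"

text \<open>For finite ground sets with the empty set feasible, no truncation happens in the two
  natural-number exponents, since the rank is monotone and bounded by the cardinality.\<close>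

definition greedoid_tutte :: "'e set_system \<Rightarrow> int_poly_xy" where
  "greedoid_tutte \<Gamma> =
     (\<Sum>A \<in> Pow (fst \<Gamma>).
        (var_x - 1) ^ (greedoid_rank \<Gamma> (fst \<Gamma>) - greedoid_rank \<Gamma> A) *
        (var_y - 1) ^ (card A - greedoid_rank \<Gamma> A))"

text \<open>The maximum exists exactly when the polynomial is nonzero.\<close>

definition ord_x :: "int_poly_xy \<Rightarrow> nat" where
  "ord_x p = Max {a. var_x ^ a dvd p}"

definition root_leaves :: "'v rooted_graph \<Rightarrow> 'v set" where
  "root_leaves G =
     {v \<in> verts G - {rootv G}. {rootv G, v} \<in> edges G \<and> graph_deg G v = 1}"

definition num_root_leaves :: "'v rooted_graph \<Rightarrow> nat" where
  "num_root_leaves G = card (root_leaves G)"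

end

theory Submission
  imports Defs
begin

text \<open>The rank of $A$ is the number of non-root vertices reachable from $r$ in $G|A$, so $T$ is
  multiplicative over edge sets that meet only in $r$. This reduces the claim to the edges meeting
  one component $K$ of $G - r$. A root leaf gives $T = x$; in every other case $T(0, y) \neq 0$,
  which can be read off the top powers of $z = y - 1$. Let $h$ be the number of edges inside $K$
  and $k = |K|$. A set $A$ contributes to $z^h$ only if it consists of all edges inside $K$, or if
  $r$ is adjacent to all of $K$ and $A$ is everything. The two signs are $(-1)^k$ and $1$, so they
  cancel only for odd $k$, and then the coefficient of $z^{h-1}$ is positive unless $k = 1$.\<close>

subsection \<open>Rank and reachability\<close>

definition arcs :: "'v set set \<Rightarrow> ('v \<times> 'v) set" where
  "arcs A = {(u, v). {u, v} \<in> A}"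

definition reach :: "'v \<Rightarrow> 'v set set \<Rightarrow> 'v set" where
  "reach r A = (arcs A)\<^sup>* `` {r}"

text \<open>The root is not counted, so this is the number of edges in a spanning tree of the root
  component; \<open>greedoid_rank_eq_rk\<close> identifies it with the greedoid rank.\<close>

definition rk :: "'v \<Rightarrow> 'v set set \<Rightarrow> nat" where
  "rk r A = card (reach r A) - 1"

text \<open>The condition \<open>cycle\<close> freed from the record, so that it depends on the edge
  set alone.\<close>

definition has_cycle :: "'v set set \<Rightarrow> bool" where
  "has_cycle A \<longleftrightarrow> (\<exists>vs. 3 \<le> length vs \<and> distinct vs \<and>
     (\<forall>i < length vs. {vs ! i, vs ! (Suc i mod length vs)} \<in> A))"

lemma not_has_cycle_empty [simp]: "\<not> has_cycle ({} :: 'v set set)"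
proof
  assume "has_cycle ({} :: 'v set set)"
  then obtain vs :: "'v list" where "3 \<le> length vs" "\<forall>i. \<not> i < length vs"
    unfolding has_cycle_def by auto
  from this(1) this(2)[rule_format, of 0] show False by simp
qed

lemma sym_arcs: "sym (arcs A)"
  by (auto simp: sym_def arcs_def insert_commute)

lemma arcs_rtrancl_sym: "(u, v) \<in> (arcs A)\<^sup>* \<Longrightarrow> (v, u) \<in> (arcs A)\<^sup>*"
  using sym_rtrancl[OF sym_arcs] by (meson symD)

lemma root_in_reach [simp]: "r \<in> reach r A"
  by (simp add: reach_def)

lemma reach_step: "u \<in> reach r A \<Longrightarrow> {u, v} \<in> A \<Longrightarrow> v \<in> reach r A"
  by (auto simp: reach_def arcs_def intro: rtrancl_into_rtrancl)

text \<open>The induction principle behind the upper bounds on \<open>reach\<close>.\<close>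

lemma reach_least:
  assumes "r \<in> S" and "\<And>u v. u \<in> S \<Longrightarrow> {u, v} \<in> A \<Longrightarrow> v \<in> S"
  shows "reach r A \<subseteq> S"
proof
  fix v assume "v \<in> reach r A"
  then have "(r, v) \<in> (arcs A)\<^sup>*" by (simp add: reach_def)
  then show "v \<in> S"
    by (induction rule: rtrancl_induct) (use assms in \<open>auto simp: arcs_def\<close>)
qed

lemma reach_mono: "A \<subseteq> B \<Longrightarrow> reach r A \<subseteq> reach r B"
  by (rule reach_least) (auto intro: reach_step)

lemma reach_subset_Union: "reach r A \<subseteq> insert r (\<Union>A)"
  by (rule reach_least) auto

lemma reach_empty [simp]: "reach r {} = {r}"
  using reach_subset_Union[of r "{}"] root_in_reach[of r "{}"] by auto

lemma finite_pairs:
  assumes "finite A" "\<forall>e\<in>A. card e = 2"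
  shows "finite (\<Union>A)"
  using assms by (metis card.infinite finite_Union zero_neq_numeral)

lemma finite_reach:
  assumes "finite A" "\<forall>e\<in>A. card e = 2"
  shows "finite (reach r A)"
  using finite_subset[OF reach_subset_Union[of r A]] finite_pairs[OF assms] by simp

lemma card_reach:
  assumes "finite A" "\<forall>e\<in>A. card e = 2"
  shows "card (reach r A) = Suc (rk r A)"
proof -
  have "card (reach r A) \<noteq> 0"
    using finite_reach[OF assms, of r] root_in_reach[of r A]
    by (auto simp del: root_in_reach)
  then show ?thesis by (simp add: rk_def)
qed

lemma rk_mono:
  assumes "A \<subseteq> B" "finite B" "\<forall>e\<in>B. card e = 2"
  shows "rk r A \<le> rk r B"
  unfolding rk_def using card_mono[OF finite_reach[OF assms(2,3)] reach_mono[OF assms(1)]]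
  by (rule diff_le_mono)

lemma reach_pairwise: "u \<in> reach r A \<Longrightarrow> v \<in> reach r A \<Longrightarrow> (u, v) \<in> (arcs A)\<^sup>*"
  unfolding reach_def using arcs_rtrancl_sym[of r u A] rtrancl_trans[of u r "arcs A" v] by simp

section \<open>Paths, cycles and the insertion of one edge\<close>

text \<open>Extend the path arc by arc; if the next vertex already lies on the path, cut the path
  off at that vertex instead.\<close>

lemma rtrancl_distinct_path:
  assumes "(u, v) \<in> R\<^sup>*"
  shows "\<exists>vs. vs \<noteq> [] \<and> hd vs = u \<and> last vs = v \<and> distinct vs \<and>
           (\<forall>i. Suc i < length vs \<longrightarrow> (vs ! i, vs ! Suc i) \<in> R)"
  using assms
proof (induction rule: rtrancl_induct)
  case base
  then show ?case by (intro exI[of _ "[u]"]) auto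
next
  case (step v w)
  then obtain vs where vs: "vs \<noteq> []" "hd vs = u" "last vs = v" "distinct vs"
    "\<forall>i. Suc i < length vs \<longrightarrow> (vs ! i, vs ! Suc i) \<in> R" by blast
  show ?case
  proof (cases "w \<in> set vs")
    case True
    then obtain j where j: "j < length vs" "vs ! j = w" by (auto simp: in_set_conv_nth)
    have "last (take (Suc j) vs) = w"
      using j by (simp add: take_Suc_conv_app_nth)
    then show ?thesis using vs j
      by (intro exI[of _ "take (Suc j) vs"]) (auto simp: hd_take)
  next
    case False
    have ext: "(vs ! i, if Suc i < length vs then vs ! Suc i else w) \<in> R"
      if "i < length vs" for i
    proof (cases "Suc i < length vs")
      case False
      then have "i = length vs - 1" using that by simp
      then have "vs ! i = v" using vs by (simp add: last_conv_nth)
      then show ?thesis using that False step by simp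
    qed (use that vs in auto)
    have "\<forall>i. Suc i < length (vs @ [w]) \<longrightarrow> ((vs @ [w]) ! i, (vs @ [w]) ! Suc i) \<in> R"
      using ext vs(5) by (auto simp: nth_append dest: ext)
    then show ?thesis using vs False
      by (intro exI[of _ "vs @ [w]"]) auto
  qed
qed

text \<open>A vertex on a cycle has two distinct neighbours there, but the only edge at
  \<open>v\<close> is \<open>{u, v}\<close>. The cycle therefore avoids \<open>v\<close>, and with
  it the new edge.\<close>

lemma has_cycle_insert_pendant:
  assumes "has_cycle (insert {u, v} B)" and "v \<notin> \<Union>B"
  shows "has_cycle B"
proof -
  obtain vs where vs: "3 \<le> length vs" "distinct vs"
    and edge: "\<And>i. i < length vs \<Longrightarrow> {vs ! i, vs ! (Suc i mod length vs)} \<in> insert {u, v} B"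
    using assms(1) unfolding has_cycle_def by blast
  let ?n = "length vs"
  have "v \<notin> set vs"
  proof
    assume "v \<in> set vs"
    then obtain i where i: "i < ?n" "vs ! i = v" by (auto simp: in_set_conv_nth)
    \<comment> \<open>\<open>s\<close> and \<open>p\<close> are the cyclic successor and predecessor
      of position \<open>i\<close>; they differ because the cycle has length at least 3.\<close>
    define s where "s = Suc i mod ?n"
    define p where "p = (if i = 0 then ?n - 1 else i - 1)"
    have p: "p < ?n" "Suc p mod ?n = i" using i vs(1) by (auto simp: p_def)
    have s: "s < ?n" "s \<noteq> p" "s \<noteq> i"
      using i vs(1) by (auto simp: s_def p_def mod_Suc split: if_splits)
    have pi: "p \<noteq> i" using i vs(1) by (auto simp: p_def)
    have "{v, vs ! s} = {u, v}" using edge[OF i(1)] assms(2) i by (auto simp: s_def)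
    moreover have "{vs ! p, v} = {u, v}" using edge[OF p(1)] assms(2) i p by auto
    moreover have "vs ! s \<noteq> v" "vs ! p \<noteq> v" "vs ! s \<noteq> vs ! p"
      using vs(2) i s p pi by (auto simp: nth_eq_iff_index_eq)
    ultimately show False by (metis doubleton_eq_iff)
  qed
  moreover have "{vs ! i, vs ! (Suc i mod ?n)} \<subseteq> set vs" if "i < ?n" for i
  proof -
    have "Suc i mod ?n < ?n" using vs(1) by (intro mod_less_divisor) linarith
    then show ?thesis using that by simp
  qed
  ultimately have "{vs ! i, vs ! (Suc i mod ?n)} \<in> B" if "i < ?n" for i
    using edge[OF that] that by (auto simp: doubleton_eq_iff)
  then show ?thesis using vs unfolding has_cycle_def by blast
qed

text \<open>The new edge closes a path from \<open>u\<close> to \<open>v\<close> with distinct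
  vertices. Such a path has at least three vertices, since \<open>u\<close> and \<open>v\<close> are
  distinct and not adjacent in \<open>B\<close>.\<close>

lemma has_cycle_insert_chord:
  assumes "(u, v) \<in> (arcs B)\<^sup>*" "{u, v} \<notin> B" "u \<noteq> v"
  shows "has_cycle (insert {u, v} B)"
proof -
  obtain vs where vs: "vs \<noteq> []" "hd vs = u" "last vs = v" "distinct vs"
    and path: "\<And>i. Suc i < length vs \<Longrightarrow> {vs ! i, vs ! Suc i} \<in> B"
    using rtrancl_distinct_path[OF assms(1)] by (auto simp: arcs_def)
  let ?n = "length vs"
  have u: "vs ! 0 = u" and v: "vs ! (?n - 1) = v"
    using vs by (simp_all add: hd_conv_nth last_conv_nth)
  have "?n \<noteq> 0" using vs by simp
  moreover have "?n \<noteq> 1" using u v assms(3) by auto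
  moreover have "?n \<noteq> 2" using u v path[of 0] assms(2) by auto
  ultimately have n: "3 \<le> ?n" by linarith
  have "{vs ! i, vs ! (Suc i mod ?n)} \<in> insert {u, v} B" if "i < ?n" for i
  proof (cases "Suc i = ?n")
    case True
    then have "vs ! i = v" "Suc i mod ?n = 0" using v by (simp_all flip: True)
    then show ?thesis using u by (simp add: insert_commute)
  next
    case False
    then show ?thesis using path[of i] that by simp
  qed
  then show ?thesis using n vs(4) unfolding has_cycle_def by blast
qed

lemma has_cycle_mono: "has_cycle A \<Longrightarrow> A \<subseteq> B \<Longrightarrow> has_cycle B"
  unfolding has_cycle_def by blast

text \<open>All edges of \<open>B\<close> lie in the reached part, so \<open>v\<close> is on none of
  them and nothing beyond \<open>v\<close> becomes reachable.\<close>

lemma reach_insert_pendant: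
  assumes "u \<in> reach r B" "v \<notin> reach r B" "\<Union>B \<subseteq> reach r B"
  shows "reach r (insert {u, v} B) = insert v (reach r B)"
proof
  show "reach r (insert {u, v} B) \<subseteq> insert v (reach r B)"
    by (rule reach_least) (use assms in \<open>auto simp: doubleton_eq_iff\<close>)
  have "reach r B \<subseteq> reach r (insert {u, v} B)" by (rule reach_mono) blast
  moreover have "v \<in> reach r (insert {u, v} B)"
    using calculation assms(1) reach_step[of u r "insert {u, v} B" v] by blast
  ultimately show "insert v (reach r B) \<subseteq> reach r (insert {u, v} B)" by blast
qed

section \<open>Spanning trees of the root component\<close>

text \<open>Take a largest tree in \<open>A\<close> containing the root. If it missed a reachable
  vertex, some edge of \<open>A\<close> would leave it, and adding that edge would give a larger
  tree.\<close>

lemma spanning_tree_exists: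
  assumes fin: "finite A" and pairs: "\<forall>e\<in>A. card e = 2"
  obtains B where "B \<subseteq> A" "reach r B = reach r A" "card B = rk r A"
    "\<not> has_cycle B" "\<Union>B \<subseteq> reach r B"
proof -
  define P where "P B \<longleftrightarrow> B \<subseteq> A \<and> card B = rk r B \<and> \<not> has_cycle B \<and> \<Union>B \<subseteq> reach r B" for B
  have "P {}"
    by (simp add: P_def rk_def)
  moreover have "card B \<le> card A" if "P B" for B
    using that card_mono[OF fin, of B] unfolding P_def by blast
  ultimately have "\<exists>B. P B \<and> (\<forall>B'. P B' \<longrightarrow> card B' \<le> card B)"
    by (intro ex_has_greatest_nat[of P "{}" card "Suc (card A)"]) (auto simp: less_Suc_eq_le)
  then obtain B where B: "P B" and maxB: "\<And>B'. P B' \<Longrightarrow> card B' \<le> card B"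
    by blast
  have finB: "finite B" and pairsB: "\<forall>e\<in>B. card e = 2"
    using B fin pairs by (auto simp: P_def intro: finite_subset)
  have "reach r A \<subseteq> reach r B"
  proof (rule reach_least, simp, rule ccontr)
    fix u v assume u: "u \<in> reach r B" and uv: "{u, v} \<in> A" and v: "v \<notin> reach r B"
    have UB: "\<Union>B \<subseteq> reach r B" using B by (simp add: P_def)
    have eq: "reach r (insert {u, v} B) = insert v (reach r B)"
      using reach_insert_pendant[OF u v UB] .
    have notin: "{u, v} \<notin> B" using v UB by auto
    have "rk r (insert {u, v} B) = Suc (rk r B)"
      using card_reach[OF finB pairsB, of r] v finite_reach[OF finB pairsB, of r]
      by (simp add: rk_def eq)
    then have "P (insert {u, v} B)"
      using B uv u v UB eq notin finB has_cycle_insert_pendant[of u v B]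
      by (auto simp: P_def)
    from maxB[OF this] show False using notin finB by simp
  qed
  moreover have "reach r B \<subseteq> reach r A" using B by (simp add: P_def reach_mono)
  ultimately show ?thesis using that[of B] B by (auto simp: P_def rk_def)
qed

text \<open>An edge of \<open>A\<close> outside a spanning tree \<open>B\<close> would join two
  vertices already connected in \<open>B\<close> and close a cycle. Hence \<open>A\<close> is its
  own spanning tree.\<close>

lemma edges_of_spanning_tree:
  assumes fin: "finite A" and pairs: "\<forall>e\<in>A. card e = 2"
    and acyc: "\<not> has_cycle A" and sub: "\<Union>A \<subseteq> reach r A"
  shows "card A = rk r A"
proof -
  obtain B where B: "B \<subseteq> A" "reach r B = reach r A" "card B = rk r A"
    using spanning_tree_exists[OF fin pairs] by metis
  have "A \<subseteq> B"
  proof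
    fix e assume e: "e \<in> A"
    then obtain u v where uv: "e = {u, v}" "u \<noteq> v" using pairs by (metis card_2_iff)
    show "e \<in> B"
    proof (rule ccontr)
      assume "e \<notin> B"
      moreover have "(u, v) \<in> (arcs B)\<^sup>*"
        using uv e sub B(2) by (intro reach_pairwise[of _ r]) auto
      ultimately have "has_cycle (insert e B)" using has_cycle_insert_chord uv by metis
      then show False using acyc has_cycle_mono B(1) e by (metis insert_subset)
    qed
  qed
  then show ?thesis using B by (metis subset_antisym)
qed

section \<open>Feasible sets and the greedoid rank\<close>

lemma simple_rooted_graph_edges:
  assumes "simple_rooted_graph G"
  shows "finite (edges G)" "\<forall>e\<in>edges G. card e = 2" "\<Union>(edges G) \<subseteq> verts G"
proof -
  have sub: "edges G \<subseteq> {{u, v} | u v. u \<in> verts G \<and> v \<in> verts G \<and> u \<noteq> v}"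
    and fin: "finite (verts G)"
    using assms by (auto simp: simple_rooted_graph_def)
  show U: "\<Union>(edges G) \<subseteq> verts G" using sub by blast
  show "finite (edges G)" using fin U by (metis finite_UnionD finite_subset)
  show "\<forall>e\<in>edges G. card e = 2" using sub by fastforce
qed

text \<open>If all edges of \<open>A\<close> lie in the root component, that component has edge set
  \<open>A\<close> and is connected, so being a tree means being acyclic. Otherwise both sides
  fail.\<close>

lemma feasible_iff:
  assumes G: "simple_rooted_graph G" and A: "A \<subseteq> edges G"
  shows "feasible G A \<longleftrightarrow> \<not> has_cycle A \<and> \<Union>A \<subseteq> reach (rootv G) A"
proof -
  let ?r = "rootv G" and ?C = "root_component (spanning_restrict G A)"
  have reach_verts: "reach ?r A \<subseteq> verts G"
    using reach_subset_Union[of ?r A] simple_rooted_graph_edges(3)[OF G] A G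
    by (auto simp: simple_rooted_graph_def)
  have adj: "adj (spanning_restrict G A) = arcs A"
    by (simp add: adj_def arcs_def spanning_restrict_def)
  have RR: "root_reach (spanning_restrict G A) = reach ?r A"
    using reach_verts unfolding root_reach_def adj by (auto simp: spanning_restrict_def reach_def)
  have C: "?C = \<lparr>verts = reach ?r A, edges = {e \<in> A. e \<subseteq> reach ?r A}, rootv = ?r\<rparr>"
    unfolding root_component_def RR by (simp add: spanning_restrict_def)
  show ?thesis
  proof (cases "\<Union>A \<subseteq> reach ?r A")
    case True
    then have eqA: "{e \<in> A. e \<subseteq> reach ?r A} = A" by blast
    have "connected_graph ?C"
      unfolding connected_graph_def C eqA using reach_pairwise[of _ ?r A] root_in_reach[of ?r A]
      by (auto simp: adj_def arcs_def simp del: root_in_reach)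
    then show ?thesis
      using True A by (simp add: feasible_def is_tree_def C eqA has_cycle_def cycle_def)
  next
    case False
    then show ?thesis by (auto simp: feasible_def C)
  qed
qed

text \<open>A feasible subset has as many edges as it reaches vertices other than the root, at most
  \<open>rk (rootv G) A\<close>; a spanning tree of the root component attains this bound.\<close>

lemma greedoid_rank_eq_rk:
  assumes G: "simple_rooted_graph G" and A: "A \<subseteq> edges G"
  shows "greedoid_rank (graph_greedoid G) A = rk (rootv G) A"
proof -
  let ?r = "rootv G"
  have fin: "finite A" and pairs: "\<forall>e\<in>A. card e = 2"
    using simple_rooted_graph_edges[OF G] A by (auto intro: finite_subset)
  show ?thesis
    unfolding greedoid_rank_def
  proof (rule Max_eqI)
    show "finite {card A' |A'. A' \<subseteq> A \<and> A' \<in> snd (graph_greedoid G)}"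
      by (rule finite_subset[of _ "card ` Pow A"]) (use fin in auto)
  next
    fix k assume "k \<in> {card A' |A'. A' \<subseteq> A \<and> A' \<in> snd (graph_greedoid G)}"
    then obtain A' where A': "k = card A'" "A' \<subseteq> A" "feasible G A'"
      by (auto simp: graph_greedoid_def)
    have "card A' = rk ?r A'"
    proof (rule edges_of_spanning_tree)
      show "finite A'" using A'(2) fin by (rule finite_subset)
      show "\<forall>e\<in>A'. card e = 2" using A'(2) pairs by blast
      have "A' \<subseteq> edges G" using A'(2) A by blast
      then show "\<not> has_cycle A'" "\<Union>A' \<subseteq> reach ?r A'"
        using feasible_iff[OF G, of A'] A'(3) by simp_all
    qed
    then show "k \<le> rk ?r A" using A' rk_mono[OF A'(2) fin pairs] by simp
  next
    obtain B where B: "B \<subseteq> A" "card B = rk ?r A" "\<not> has_cycle B" "\<Union>B \<subseteq> reach ?r B"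
      using spanning_tree_exists[OF fin pairs] by metis
    then have "feasible G B" using feasible_iff[OF G, of B] A by blast
    then show "rk ?r A \<in> {card A' |A'. A' \<subseteq> A \<and> A' \<in> snd (graph_greedoid G)}"
      using B(1,2) by (auto simp: graph_greedoid_def intro!: exI[of _ B])
  qed
qed

subsection \<open>Multiplicativity\<close>

lemma rk_le_card:
  assumes "finite A" "\<forall>e\<in>A. card e = 2"
  shows "rk r A \<le> card A"
  using spanning_tree_exists[OF assms, of r] card_mono[OF assms(1)] by metis

text \<open>Depends only on the root and the edge set, so that the edge set can be split freely; the
  vertex set of the graph no longer enters.\<close>

definition rooted_tutte :: "'v \<Rightarrow> 'v set set \<Rightarrow> int_poly_xy" where
  "rooted_tutte r E =
     (\<Sum>A \<in> Pow E. (var_x - 1) ^ (rk r E - rk r A) * (var_y - 1) ^ (card A - rk r A))"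

definition leaves_at :: "'v \<Rightarrow> 'v set set \<Rightarrow> 'v set" where
  "leaves_at r E = {v. v \<noteq> r \<and> {r, v} \<in> E \<and> card {e \<in> E. v \<in> e} = 1}"

text \<open>A walk can pass from an edge of \<open>A\<close> to one of \<open>B\<close> only at
  \<open>r\<close>, where both sides can start afresh.\<close>

lemma reach_Un:
  assumes "\<Union>A \<inter> \<Union>B \<subseteq> {r}"
  shows "reach r (A \<union> B) = reach r A \<union> reach r B"
proof
  show "reach r A \<union> reach r B \<subseteq> reach r (A \<union> B)"
    using reach_mono[of A "A \<union> B" r] reach_mono[of B "A \<union> B" r] by simp
  have step: "v \<in> reach r A \<union> reach r B"
    if uv: "{u, v} \<in> A \<union> B" and u: "u \<in> reach r A \<union> reach r B" for u v
  proof (cases "u = r")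
    case True
    then show ?thesis using uv by (auto intro: reach_step[OF root_in_reach])
  next
    case False
    then have "u \<in> \<Union>A \<and> u \<notin> \<Union>B \<and> u \<in> reach r A \<or> u \<in> \<Union>B \<and> u \<notin> \<Union>A \<and> u \<in> reach r B"
      using u assms reach_subset_Union[of r A] reach_subset_Union[of r B] by blast
    then show ?thesis using uv reach_step[of u r A v] reach_step[of u r B v] by blast
  qed
  show "reach r (A \<union> B) \<subseteq> reach r A \<union> reach r B"
    by (rule reach_least) (use step in auto)
qed

lemma rk_Un:
  assumes "\<Union>A \<inter> \<Union>B \<subseteq> {r}" "finite A" "finite B" "\<forall>e\<in>A \<union> B. card e = 2"
  shows "rk r (A \<union> B) = rk r A + rk r B"
proof -
  have pairs: "\<forall>e\<in>A. card e = 2" "\<forall>e\<in>B. card e = 2" using assms(4) by auto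
  have "reach r A \<inter> reach r B = {r}"
    using reach_subset_Union[of r A] reach_subset_Union[of r B] assms(1) root_in_reach[of r A]
      root_in_reach[of r B] by blast
  \<comment> \<open>Inclusion-exclusion: the final 1 counts the common vertex
    \<open>r\<close>.\<close>
  then have "Suc (rk r A) + Suc (rk r B) = Suc (rk r (A \<union> B)) + 1"
    using card_Un_Int[OF finite_reach[OF assms(2) pairs(1), of r] finite_reach[OF assms(3) pairs(2), of r]]
    by (simp add: card_reach assms(2-4) pairs flip: reach_Un[OF assms(1)])
  then show ?thesis by simp
qed

text \<open>Each subset of the union splits uniquely into a subset of \<open>E1\<close> and one of
  \<open>E2\<close>. Cardinality and rank add up, so the terms multiply.\<close>

lemma rooted_tutte_Un:
  assumes sep: "\<Union>E1 \<inter> \<Union>E2 \<subseteq> {r}" and fin: "finite E1" "finite E2"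
    and pairs: "\<forall>e\<in>E1 \<union> E2. card e = 2"
  shows "rooted_tutte r (E1 \<union> E2) = rooted_tutte r E1 * rooted_tutte r E2"
proof -
  define t where "t E A = (var_x - 1) ^ (rk r E - rk r A) * (var_y - 1) ^ (card A - rk r A)" for E A
  have disj: "E1 \<inter> E2 = {}"
  proof (rule ccontr)
    assume "E1 \<inter> E2 \<noteq> {}"
    then obtain e where e: "e \<in> E1" "e \<in> E2" by blast
    then have "e \<subseteq> {r}" using sep by blast
    then have "card e \<le> 1" using card_mono[of "{r}" e] by simp
    then show False using pairs e by fastforce
  qed
  have mult: "t (E1 \<union> E2) (A \<union> B) = t E1 A * t E2 B" if A: "A \<subseteq> E1" and B: "B \<subseteq> E2" for A B
  proof -
    have finAB: "finite A" "finite B" using A B fin by (auto intro: finite_subset)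
    have pA: "\<forall>e\<in>A. card e = 2" and pB: "\<forall>e\<in>B. card e = 2" using A B pairs by auto
    have rkAB: "rk r (A \<union> B) = rk r A + rk r B"
    proof (rule rk_Un[OF _ finAB])
      show "\<Union>A \<inter> \<Union>B \<subseteq> {r}" using A B sep by blast
      show "\<forall>e\<in>A \<union> B. card e = 2" using pA pB by blast
    qed
    have cardAB: "card (A \<union> B) = card A + card B"
      using disj A B by (intro card_Un_disjoint finAB) blast
    \<comment> \<open>These bounds make the differences in the exponents exact, hence
      additive.\<close>
    have "rk r A \<le> rk r E1" "rk r B \<le> rk r E2" using A B fin pairs by (auto intro: rk_mono)
    then have "rk r E1 + rk r E2 - (rk r A + rk r B) = (rk r E1 - rk r A) + (rk r E2 - rk r B)"
      by simp
    moreover have "card A + card B - (rk r A + rk r B) = (card A - rk r A) + (card B - rk r B)"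
      using rk_le_card[OF finAB(1) pA, of r] rk_le_card[OF finAB(2) pB, of r] by simp
    ultimately show ?thesis
      by (simp add: t_def rk_Un[OF sep fin pairs] rkAB cardAB power_add mult_ac)
  qed
  have "rooted_tutte r E1 * rooted_tutte r E2 =
      (\<Sum>(A, B) \<in> Pow E1 \<times> Pow E2. t E1 A * t E2 B)"
    unfolding rooted_tutte_def t_def by (simp add: sum_product sum.cartesian_product)
  also have "\<dots> = (\<Sum>A \<in> Pow (E1 \<union> E2). t (E1 \<union> E2) A)"
  proof (rule sum.reindex_bij_witness[of _ "\<lambda>A. (A \<inter> E1, A \<inter> E2)" "\<lambda>(A, B). A \<union> B"])
    fix p assume "p \<in> Pow E1 \<times> Pow E2"
    then show "(case p of (A, B) \<Rightarrow> A \<union> B) \<in> Pow (E1 \<union> E2)" by auto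
  next
    fix p assume "p \<in> Pow E1 \<times> Pow E2"
    then show "((case p of (A, B) \<Rightarrow> A \<union> B) \<inter> E1, (case p of (A, B) \<Rightarrow> A \<union> B) \<inter> E2) = p"
      using disj by auto
  next
    fix p assume "p \<in> Pow E1 \<times> Pow E2"
    then show "t (E1 \<union> E2) (case p of (A, B) \<Rightarrow> A \<union> B) = (case p of (A, B) \<Rightarrow> t E1 A * t E2 B)"
      using mult by auto
  qed auto
  finally show ?thesis by (simp add: rooted_tutte_def t_def)
qed

text \<open>A vertex other than \<open>r\<close> that is joined to \<open>r\<close> in one part lies
  on no edge of the other part, so its degree is that in its own part.\<close>

lemma leaves_at_Un:
  assumes sep: "\<Union>E1 \<inter> \<Union>E2 \<subseteq> {r}"
  shows "leaves_at r (E1 \<union> E2) = leaves_at r E1 \<union> leaves_at r E2"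
    and "leaves_at r E1 \<inter> leaves_at r E2 = {}"
proof -
  have 1: "{e \<in> E1 \<union> E2. v \<in> e} = {e \<in> E1. v \<in> e}" if "{r, v} \<in> E1" "v \<noteq> r" for v
    using that sep by blast
  have 2: "{e \<in> E1 \<union> E2. v \<in> e} = {e \<in> E2. v \<in> e}" if "{r, v} \<in> E2" "v \<noteq> r" for v
    using that sep by blast
  show "leaves_at r (E1 \<union> E2) = leaves_at r E1 \<union> leaves_at r E2"
    unfolding leaves_at_def using 1 2 by auto
  show "leaves_at r E1 \<inter> leaves_at r E2 = {}"
    unfolding leaves_at_def using sep by blast
qed

lemma finite_leaves_at:
  assumes "finite E" "\<forall>e\<in>E. card e = 2"
  shows "finite (leaves_at r E)"
  by (rule finite_subset[OF _ finite_pairs[OF assms]]) (auto simp: leaves_at_def)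

subsection \<open>The polynomial at $x = 0$\<close>

text \<open>This is $T(0, 1 + z)$.\<close>

definition tutte_z :: "'v \<Rightarrow> 'v set set \<Rightarrow> int poly" where
  "tutte_z r E = (\<Sum>A \<in> Pow E. monom ((- 1) ^ (rk r E - rk r A)) (card A - rk r A))"

text \<open>Setting x = 0 turns x - 1 into the sign -1, and substituting y = 1 + z turns y - 1 into
  z; every edge subset then gives a signed monomial.\<close>

lemma pcompose_rooted_tutte:
  "pcompose (poly (rooted_tutte r E) 0) [:1, 1:] = tutte_z r E"
proof -
  have y: "pcompose ([:0, 1:] - 1) [:1, 1:] = ([:0, 1:] :: int poly)"
    by (simp add: pcompose_diff pcompose_pCons pcompose_1 one_pCons)
  have pow: "pcompose (p ^ n) q = pcompose p q ^ n" for p q :: "int poly" and n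
    by (induction n) (simp_all add: pcompose_mult pcompose_1)
  have "pcompose (poly ((var_x - 1) ^ i * (var_y - 1) ^ j) 0) [:1, 1:] = monom ((- 1) ^ i) j" for i j
  proof -
    have "poly ((var_x - 1) ^ i * (var_y - 1) ^ j) 0 = (- 1) ^ i * ([:0, 1:] - 1) ^ j"
      by (simp add: var_x_def var_y_def)
    moreover have "(- 1 :: int poly) ^ i = [:(- 1) ^ i:]"
      by (induction i) (simp_all add: one_pCons)
    ultimately show ?thesis
      by (simp add: pcompose_smult pow y monom_altdef )
  qed
  then show ?thesis
    by (simp add: rooted_tutte_def tutte_z_def poly_sum pcompose_sum)
qed

lemma poly_rooted_tutte_nonzero:
  assumes "coeff (tutte_z r E) n \<noteq> 0"
  shows "poly (rooted_tutte r E) 0 \<noteq> 0"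
  using assms by (metis pcompose_rooted_tutte pcompose_0 coeff_0)

lemma coeff_tutte_z:
  assumes "finite E"
  shows "coeff (tutte_z r E) n = (\<Sum>A | A \<subseteq> E \<and> card A - rk r A = n. (- 1) ^ (rk r E - rk r A))"
proof -
  have "{A \<in> Pow E. card A - rk r A = n} = {A. A \<subseteq> E \<and> card A - rk r A = n}" by auto
  then show ?thesis
    using assms by (simp add: tutte_z_def coeff_sum sum.inter_filter[symmetric])
qed

section \<open>Splitting an edge set at the root\<close>

definition inner_edges :: "'v \<Rightarrow> 'v set set \<Rightarrow> 'v set set" where
  "inner_edges r A = {e \<in> A. r \<notin> e}"

text \<open>Records the edges at the root by their other ends, so that they can be compared with
  vertex sets and complemented there.\<close>

definition root_nbrs :: "'v \<Rightarrow> 'v set set \<Rightarrow> 'v set" where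
  "root_nbrs r A = {v. {r, v} \<in> A}"

lemma edges_split:
  assumes "\<forall>e\<in>A. card e = 2"
  shows "A = inner_edges r A \<union> (\<lambda>v. {r, v}) ` root_nbrs r A"
proof -
  have "\<exists>v. e = {r, v}" if "e \<in> A" "r \<in> e" for e
    using assms that by (metis card_2_iff insert_commute insert_iff singletonD)
  then show ?thesis by (force simp: inner_edges_def root_nbrs_def)
qed

lemma root_notin_root_nbrs:
  assumes "\<forall>e\<in>A. card e = 2"
  shows "r \<notin> root_nbrs r A"
  using assms by (fastforce simp: root_nbrs_def)

lemma inj_on_root_edge: "inj_on (\<lambda>v. {r, v}) X"
  by (auto simp: inj_on_def doubleton_eq_iff)

lemma card_edges_split:
  assumes "finite A" "\<forall>e\<in>A. card e = 2"
  shows "card A = card (inner_edges r A) + card (root_nbrs r A)"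
proof -
  have eq: "A = inner_edges r A \<union> (\<lambda>v. {r, v}) ` root_nbrs r A"
    by (rule edges_split[OF assms(2)])
  have "inner_edges r A \<inter> (\<lambda>v. {r, v}) ` root_nbrs r A = {}"
    by (auto simp: inner_edges_def)
  moreover have "finite (inner_edges r A)" "finite ((\<lambda>v. {r, v}) ` root_nbrs r A)"
    using assms(1) by (auto simp: inner_edges_def root_nbrs_def intro: finite_subset[of _ A])
  ultimately have "card A = card (inner_edges r A) + card ((\<lambda>v. {r, v}) ` root_nbrs r A)"
    by (subst eq) (rule card_Un_disjoint; simp)
  then show ?thesis by (simp add: card_image inj_on_root_edge)
qed

lemma root_nbrs_subset_reach: "root_nbrs r A \<subseteq> reach r A"
  by (auto simp: root_nbrs_def intro: reach_step[OF root_in_reach])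

lemma reach_no_root_nbrs:
  assumes "root_nbrs r A = {}"
  shows "reach r A = {r}"
proof
  show "reach r A \<subseteq> {r}"
    by (rule reach_least) (use assms in \<open>auto simp: root_nbrs_def\<close>)
qed simp

subsection \<open>A single component away from the root\<close>

text \<open>\<open>K\<close> models a component of the graph without its root, and \<open>E\<close>
  the edges meeting it. No edge at \<open>r\<close> is required, so \<open>K\<close> may be
  unreachable.\<close>

locale rooted_block =
  fixes r :: 'v and E :: "'v set set" and K :: "'v set"
  assumes finE: "finite E"
    and pairsE: "\<forall>e\<in>E. card e = 2"
    and finK: "finite K" and K_ne: "K \<noteq> {}" and r_notin_K: "r \<notin> K"
    and edgesE: "\<forall>e\<in>E. e \<subseteq> insert r K"
    and connK: "\<And>u v. u \<in> K \<Longrightarrow> v \<in> K \<Longrightarrow> (u, v) \<in> (arcs (inner_edges r E))\<^sup>*"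
begin

abbreviation "b A \<equiv> card (inner_edges r A)"
abbreviation "c A \<equiv> card (root_nbrs r A)"

lemma subgraph:
  assumes "A \<subseteq> E"
  shows "finite A" "\<forall>e\<in>A. card e = 2" "root_nbrs r A \<subseteq> K" "inner_edges r A \<subseteq> inner_edges r E"
    "root_nbrs r A \<subseteq> root_nbrs r E" "finite (root_nbrs r A)" "reach r A \<subseteq> insert r K"
    "finite (inner_edges r A)"
proof -
  show "finite A" using assms finE by (rule finite_subset)
  then show "finite (inner_edges r A)" by (simp add: inner_edges_def)
  show pairs: "\<forall>e\<in>A. card e = 2" using assms pairsE by blast
  show K: "root_nbrs r A \<subseteq> K"
    using assms edgesE root_notin_root_nbrs[OF pairs, of r] by (force simp: root_nbrs_def)
  show "finite (root_nbrs r A)" using K finK by (rule finite_subset)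
  show "inner_edges r A \<subseteq> inner_edges r E" "root_nbrs r A \<subseteq> root_nbrs r E"
    using assms by (auto simp: inner_edges_def root_nbrs_def)
  show "reach r A \<subseteq> insert r K"
    using reach_subset_Union[of r A] assms edgesE by blast
qed

lemma edge_sets_eqI:
  assumes "A \<subseteq> E" "B \<subseteq> E" "inner_edges r A = inner_edges r B" "root_nbrs r A = root_nbrs r B"
  shows "A = B"
  using edges_split[OF subgraph(2)[OF assms(1)], of r] edges_split[OF subgraph(2)[OF assms(2)], of r] assms(3,4)
  by simp

lemma finite_reach_sub: "A \<subseteq> E \<Longrightarrow> finite (reach r A)"
  by (rule finite_reach[OF subgraph(1,2)])

lemma c_le_rk: "A \<subseteq> E \<Longrightarrow> c A \<le> rk r A"
proof -
  assume A: "A \<subseteq> E"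
  have "insert r (root_nbrs r A) \<subseteq> reach r A" using root_nbrs_subset_reach[of r A] by simp
  then have "card (insert r (root_nbrs r A)) \<le> card (reach r A)"
    by (rule card_mono[OF finite_reach_sub[OF A]])
  then show "c A \<le> rk r A"
    using root_notin_root_nbrs[OF subgraph(2)[OF A], of r] subgraph(6)[OF A] card_reach[OF subgraph(1,2)[OF A], of r]
    by simp
qed

lemma rk_no_root_nbrs: "root_nbrs r A = {} \<Longrightarrow> rk r A = 0"
  by (simp add: rk_def reach_no_root_nbrs)

text \<open>One root edge leads into \<open>K\<close>, and the inner edges connect \<open>K\<close>,
  so all of \<open>K\<close> is reached.\<close>

lemma rk_full:
  assumes A: "A \<subseteq> E" and inner: "inner_edges r A = inner_edges r E" and ne: "root_nbrs r A \<noteq> {}"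
  shows "rk r A = card K"
proof -
  obtain u where u: "u \<in> root_nbrs r A" using ne by blast
  have "v \<in> reach r A" if v: "v \<in> K" for v
  proof -
    have "(u, v) \<in> (arcs (inner_edges r E))\<^sup>*" using u v subgraph(3)[OF A] by (auto intro: connK)
    moreover have "arcs (inner_edges r E) \<subseteq> arcs A"
      using inner[symmetric] by (auto simp: arcs_def inner_edges_def)
    ultimately have "(u, v) \<in> (arcs A)\<^sup>*" using rtrancl_mono by blast
    moreover have "(r, u) \<in> (arcs A)\<^sup>*" using u root_nbrs_subset_reach[of r A] by (auto simp: reach_def)
    ultimately show ?thesis by (auto simp: reach_def)
  qed
  then have "reach r A = insert r K" using subgraph(7)[OF A] by auto
  then show ?thesis using finK r_notin_K by (simp add: rk_def)
qed

lemma b_le: "A \<subseteq> E \<Longrightarrow> b A \<le> b E"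
  using subgraph(4)[of A] subgraph(8)[of E] by (simp add: card_mono)

lemma b_eq_iff: "A \<subseteq> E \<Longrightarrow> b A = b E \<longleftrightarrow> inner_edges r A = inner_edges r E"
  using card_subset_eq[OF subgraph(8)[OF subset_refl] subgraph(4)[of A]] by auto

lemma nullity:
  assumes "A \<subseteq> E"
  shows "card A - rk r A = b A + c A - rk r A" "rk r A \<le> b A + c A"
  using card_edges_split[OF subgraph(1,2)[OF assms], of r] rk_le_card[OF subgraph(1,2)[OF assms], of r] by simp_all

section \<open>The two highest coefficients in z\<close>

text \<open>The nullity is \<open>b A + c A - rk r A\<close> with \<open>b A \<le> b E\<close> and
  \<open>c A \<le> rk r A\<close>, so reaching \<open>b E\<close> forces equality in both. Then
  either \<open>A\<close> has no root edge, or its rank is \<open>card K\<close> and the root is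
  joined in \<open>A\<close> to all of \<open>K\<close>.\<close>

lemma max_nullity_iff:
  assumes A: "A \<subseteq> E"
  shows "card A - rk r A = b E \<longleftrightarrow>
    A = inner_edges r E \<or> root_nbrs r E = K \<and> A = E"
proof
  assume eq: "card A - rk r A = b E"
  then have "b A = b E" and c: "c A = rk r A"
    using nullity[OF A] c_le_rk[OF A] b_le[OF A] by linarith+
  then have inner: "inner_edges r A = inner_edges r E" using b_eq_iff[OF A] by simp
  show "A = inner_edges r E \<or> root_nbrs r E = K \<and> A = E"
  proof (cases "root_nbrs r A = {}")
    case True
    then show ?thesis using edges_split[OF subgraph(2)[OF A], of r] inner by simp
  next
    case False
    then have "c A = card K" using rk_full[OF A inner] c by simp
    then have "root_nbrs r A = K" using card_subset_eq[OF finK subgraph(3)[OF A]] by simp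
    moreover then have "root_nbrs r E = K" using subgraph(3)[of E] subgraph(5)[OF A] by auto
    ultimately show ?thesis using edge_sets_eqI[OF A _ inner] by simp
  qed
next
  assume "A = inner_edges r E \<or> root_nbrs r E = K \<and> A = E"
  then show "card A - rk r A = b E"
  proof
    assume "A = inner_edges r E"
    moreover have "root_nbrs r (inner_edges r E) = {}" by (auto simp: root_nbrs_def inner_edges_def)
    ultimately show ?thesis by (simp add: rk_no_root_nbrs)
  next
    assume "root_nbrs r E = K \<and> A = E"
    then show ?thesis using rk_full[of E] nullity[of E] K_ne by simp
  qed
qed

text \<open>The set of all inner edges has rank 0 and gives the power of -1; \<open>E\<close> itself
  gives exponent 0 and hence the summand 1, provided that the root is joined to all of
  \<open>K\<close>.\<close>

lemma coeff_top:
  "coeff (tutte_z r E) (b E) = (- 1) ^ rk r E + (if root_nbrs r E = K then 1 else 0)"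
proof -
  have inner: "inner_edges r E \<subseteq> E" by (auto simp: inner_edges_def)
  have none: "root_nbrs r (inner_edges r E) = {}" by (auto simp: root_nbrs_def inner_edges_def)
  have "{A. A \<subseteq> E \<and> card A - rk r A = b E} = {inner_edges r E} \<union> (if root_nbrs r E = K then {E} else {})"
    using max_nullity_iff inner by auto
  moreover have "root_nbrs r E = K \<Longrightarrow> inner_edges r E \<noteq> E" using none K_ne by auto
  ultimately show ?thesis
    by (simp add: coeff_tutte_z[OF finE] rk_no_root_nbrs[OF none])
qed

text \<open>If \<open>card K\<close> is odd, the two contributions in \<open>coeff_top\<close> cancel. One degree lower, the sets
  containing all inner edges and missing exactly one root edge contribute $+1$ each. The other
  contributions come from sets missing one inner edge in which every reached vertex is joined
  directly to the root; complementing the set of root edges within \<open>K\<close> preserves this and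
  flips the sign.\<close>

lemma coeff_subtop:
  assumes cone: "root_nbrs r E = K" and odd: "odd (card K)" and k1: "card K \<noteq> 1"
  shows "coeff (tutte_z r E) (b E - 1) > 0"
proof -
  let ?s = "\<lambda>A. (- 1 :: int) ^ (card K - rk r A)"
  define S1 where "S1 = {A. A \<subseteq> E \<and> inner_edges r A = inner_edges r E \<and> Suc (c A) = card K}"
  define S2 where "S2 = {A. A \<subseteq> E \<and> Suc (b A) = b E \<and> rk r A = c A}"
  have rkE: "rk r E = card K" using rk_full[of E] cone K_ne by simp
  have "card K \<noteq> 0" using finK K_ne by simp
  \<comment> \<open>Leaves every set in \<open>S1\<close> with a root edge, so that
    \<open>rk_full\<close> applies to it.\<close>
  then have k3: "3 \<le> card K" using odd k1 by presburger
  \<comment> \<open>Makes \<open>b E - 1\<close> a genuine predecessor: two distinct vertices of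
    \<open>K\<close> need an inner edge to be connected.\<close>
  have bE: "0 < b E"
  proof -
    have "\<not> card K \<le> Suc 0" using k3 by simp
    then obtain u v where "u \<in> K" "v \<in> K" "u \<noteq> v"
      unfolding card_le_Suc0_iff_eq[OF finK] by blast
    then have "arcs (inner_edges r E) \<noteq> {}" using connK[of u v] by auto
    then show ?thesis using subgraph(8)[of E] by (auto simp: card_gt_0_iff arcs_def)
  qed
  have S: "{A. A \<subseteq> E \<and> card A - rk r A = b E - 1} = S1 \<union> S2"
  proof (intro set_eqI iffI)
    fix A assume "A \<in> {A. A \<subseteq> E \<and> card A - rk r A = b E - 1}"
    then have A: "A \<subseteq> E" and eq: "b A + c A - rk r A = b E - 1" using nullity by auto
    \<comment> \<open>The defects \<open>b E - b A\<close> and \<open>rk r A - c A\<close> are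
      nonnegative and add up to 1, so exactly one of them is 1.\<close>
    consider "b A = b E" "rk r A = Suc (c A)" | "Suc (b A) = b E" "rk r A = c A"
      using eq nullity(2)[OF A] c_le_rk[OF A] b_le[OF A] bE by linarith
    then show "A \<in> S1 \<union> S2"
    proof cases
      case 1
      then have inner: "inner_edges r A = inner_edges r E" using b_eq_iff[OF A] by simp
      have "root_nbrs r A \<noteq> {}" using 1(2) rk_no_root_nbrs[of A] by auto
      then show ?thesis using 1 rk_full[OF A inner] A inner by (simp add: S1_def)
    next
      case 2
      then show ?thesis using A by (simp add: S2_def)
    qed
  next
    fix A assume "A \<in> S1 \<union> S2"
    then show "A \<in> {A. A \<subseteq> E \<and> card A - rk r A = b E - 1}"
    proof
      assume A: "A \<in> S1"
      then have "root_nbrs r A \<noteq> {}" using k3 by (auto simp: S1_def)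
      then have "rk r A = card K" using A rk_full by (auto simp: S1_def)
      then show ?thesis using A nullity(1)[of A] by (auto simp: S1_def)
    next
      assume "A \<in> S2"
      then show ?thesis using nullity(1)[of A] by (auto simp: S2_def)
    qed
  qed
  have disj: "S1 \<inter> S2 = {}" by (auto simp: S1_def S2_def)
  have fin: "finite S1" "finite S2"
    using finE by (auto simp: S1_def S2_def intro: finite_subset[of _ "Pow E"])
  have sum1: "sum ?s S1 = int (card S1)"
  proof -
    have "?s A = 1" if "A \<in> S1" for A
    proof -
      have "root_nbrs r A \<noteq> {}" using k3 that by (auto simp: S1_def)
      then show ?thesis using that rk_full[of A] by (simp add: S1_def)
    qed
    then show ?thesis by simp
  qed
  have S1_ne: "S1 \<noteq> {}"
  proof -
    obtain v where v: "v \<in> K" using K_ne by blast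
    let ?A = "E - {{r, v}}"
    have "inner_edges r ?A = inner_edges r E" by (auto simp: inner_edges_def)
    moreover have "root_nbrs r ?A = K - {v}"
      using cone by (auto simp: root_nbrs_def doubleton_eq_iff)
    ultimately have "?A \<in> S1" using v finK k3 by (simp add: S1_def)
    then show ?thesis by blast
  qed
  have sum2: "sum ?s S2 = 0"
  proof -
    \<comment> \<open>Keeps the inner edges and complements the root neighbours; by
      \<open>cone\<close> the root edges introduced lie in \<open>E\<close>.\<close>
    define \<phi> where "\<phi> A = inner_edges r A \<union> (\<lambda>v. {r, v}) ` (K - root_nbrs r A)" for A
    have nbrs: "root_nbrs r (\<phi> A) = K - root_nbrs r A" for A
      by (auto simp: \<phi>_def root_nbrs_def inner_edges_def doubleton_eq_iff)
    have inner: "inner_edges r (\<phi> A) = inner_edges r A" for A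
      by (auto simp: \<phi>_def inner_edges_def)
    have sub_\<phi>: "\<phi> A \<subseteq> E" if "A \<subseteq> E" for A
      using that cone by (auto simp: \<phi>_def inner_edges_def root_nbrs_def)
    have rk_\<phi>: "rk r (\<phi> A) = c (\<phi> A)" and c_\<phi>: "c (\<phi> A) = card K - c A" and cK: "c A \<le> card K"
      if A: "A \<in> S2" for A
    proof -
      have AE: "A \<subseteq> E" using A by (simp add: S2_def)
      show "c (\<phi> A) = card K - c A"
        unfolding nbrs using subgraph(3,6)[OF AE] by (simp add: card_Diff_subset)
      show "c A \<le> card K" using subgraph(3)[OF AE] finK by (rule card_mono[rotated])
      \<comment> \<open>The equality \<open>rk r A = c A\<close> leaves no room for reached vertices
        besides the root and its neighbours.\<close>
      have "card (reach r A) = card (insert r (root_nbrs r A))"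
        using A card_reach[OF subgraph(1,2)[OF AE], of r] subgraph(6)[OF AE]
          root_notin_root_nbrs[OF subgraph(2)[OF AE], of r]
        by (simp add: S2_def)
      then have reachA: "reach r A = insert r (root_nbrs r A)"
        using card_subset_eq[OF finite_reach_sub[OF AE], of "insert r (root_nbrs r A)"]
          root_nbrs_subset_reach[of r A] by simp
      \<comment> \<open>No inner edge of \<open>A\<close> leaves its set of root neighbours, hence
        none leaves the complement in \<open>K\<close> either.\<close>
      have "reach r (\<phi> A) \<subseteq> insert r (root_nbrs r (\<phi> A))"
      proof (rule reach_least)
        fix u v assume u: "u \<in> insert r (root_nbrs r (\<phi> A))" and uv: "{u, v} \<in> \<phi> A"
        show "v \<in> insert r (root_nbrs r (\<phi> A))"
        proof (cases "u = r \<or> v = r")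
          case True
          then show ?thesis using uv by (auto simp: root_nbrs_def)
        next
          case False
          then have "{u, v} \<in> inner_edges r A" using uv by (auto simp: \<phi>_def)
          then have "{v, u} \<in> A" by (simp add: inner_edges_def insert_commute)
          moreover have "v \<in> K" using calculation bspec[OF edgesE, of "{v, u}"] AE False by auto
          moreover have "v \<notin> root_nbrs r A"
          proof
            assume "v \<in> root_nbrs r A"
            then have "u \<in> reach r A" using \<open>{v, u} \<in> A\<close> reachA reach_step[of v r A u] by simp
            then show False using u False by (simp add: reachA nbrs)
          qed
          ultimately show ?thesis by (simp add: nbrs)
        qed
      qed simp
      then have "card (reach r (\<phi> A)) \<le> card (insert r (root_nbrs r (\<phi> A)))"
        using subgraph(6)[OF sub_\<phi>[OF AE]] by (simp add: card_mono)
      then have "rk r (\<phi> A) \<le> c (\<phi> A)"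
        using subgraph(1,2,6)[OF sub_\<phi>[OF AE]] card_reach[of "\<phi> A" r]
          root_notin_root_nbrs[of "\<phi> A" r] by simp
      then show "rk r (\<phi> A) = c (\<phi> A)" using c_le_rk[OF sub_\<phi>[OF AE]] by simp
    qed
    have \<phi>_S2: "\<phi> A \<in> S2" and \<phi>_\<phi>: "\<phi> (\<phi> A) = A" and sign: "- ?s (\<phi> A) = ?s A"
      if A: "A \<in> S2" for A
    proof -
      have AE: "A \<subseteq> E" using A by (simp add: S2_def)
      show "\<phi> A \<in> S2"
        using A sub_\<phi>[OF AE] rk_\<phi>[OF A] by (simp add: S2_def inner)
      show "\<phi> (\<phi> A) = A"
      proof (rule edge_sets_eqI[OF sub_\<phi>[OF sub_\<phi>[OF AE]] AE])
        show "inner_edges r (\<phi> (\<phi> A)) = inner_edges r A" by (simp only: inner)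
        show "root_nbrs r (\<phi> (\<phi> A)) = root_nbrs r A"
          unfolding nbrs using subgraph(3)[OF AE] by blast
      qed
      \<comment> \<open>The two sign exponents add up to the odd number \<open>card K\<close>, so
        their parities differ.\<close>
      have "card K - rk r A + (card K - rk r (\<phi> A)) = card K"
        using A rk_\<phi>[OF A] c_\<phi>[OF A] cK[OF A] by (simp add: S2_def)
      then have "even (card K - rk r A) \<longleftrightarrow> odd (card K - rk r (\<phi> A))"
        using odd even_add[of "card K - rk r A" "card K - rk r (\<phi> A)"] by argo
      then show "- ?s (\<phi> A) = ?s A"
        by (cases "even (card K - rk r A)") simp_all
    qed
    \<comment> \<open>Reindexing along the sign-reversing involution \<open>\<phi>\<close> equates
      the sum with its own negative.\<close>
    have "sum ?s S2 = (\<Sum>A\<in>S2. - ?s A)"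
      by (rule sum.reindex_bij_witness[of _ \<phi> \<phi>]) (fact \<phi>_S2 \<phi>_\<phi> sign)+
    also have "\<dots> = - sum ?s S2" by (rule sum_negf)
    finally show ?thesis by linarith
  qed
  have "coeff (tutte_z r E) (b E - 1) = sum ?s S1 + sum ?s S2"
    unfolding coeff_tutte_z[OF finE] S rkE by (rule sum.union_disjoint[OF fin disj])
  then show ?thesis using sum1 sum2 S1_ne fin by (simp add: card_gt_0_iff)
qed

text \<open>Outside the case covered by \<open>coeff_subtop\<close> the top coefficient survives: it
  is 1 or -1 if the root misses a vertex of \<open>K\<close>, and 2 if it is joined to all of an
  even \<open>K\<close>.\<close>

lemma poly_nonzero:
  assumes "root_nbrs r E \<noteq> K \<or> card K \<noteq> 1"
  shows "poly (rooted_tutte r E) 0 \<noteq> 0"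
proof (cases "root_nbrs r E = K \<and> odd (card K)")
  case True
  then show ?thesis using assms coeff_subtop poly_rooted_tutte_nonzero by (metis less_irrefl)
next
  case False
  have "root_nbrs r E = K \<Longrightarrow> rk r E = card K" using rk_full[of E] K_ne by simp
  then have "coeff (tutte_z r E) (b E) \<noteq> 0" using False by (auto simp: coeff_top)
  then show ?thesis by (rule poly_rooted_tutte_nonzero)
qed

text \<open>If \<open>K\<close> has a second vertex, connectivity gives each root neighbour an inner
  edge besides its root edge, so its degree is at least 2.\<close>

lemma no_leaves:
  assumes "root_nbrs r E \<noteq> K \<or> card K \<noteq> 1"
  shows "leaves_at r E = {}"
proof (rule ccontr)
  assume "leaves_at r E \<noteq> {}"
  then obtain v where v: "{r, v} \<in> E" and one: "card {e \<in> E. v \<in> e} = 1" by (auto simp: leaves_at_def)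
  have vK: "v \<in> root_nbrs r E" "v \<in> K" using v subgraph(3)[of E] by (auto simp: root_nbrs_def)
  have "K \<noteq> {v}"
    using assms vK subgraph(3)[of E] by auto
  then obtain w where "w \<in> K" "w \<noteq> v" using vK by auto
  \<comment> \<open>The first arc of a path from \<open>v\<close> to \<open>w\<close>.\<close>
  then obtain x where x: "{v, x} \<in> inner_edges r E"
    using connK[OF vK(2)] by (metis arcs_def case_prodD converse_rtranclE mem_Collect_eq)
  then have "{{r, v}, {v, x}} \<subseteq> {e \<in> E. v \<in> e}" using v by (auto simp: inner_edges_def)
  moreover have "{r, v} \<noteq> {v, x}" using x by (auto simp: inner_edges_def)
  ultimately show False using one card_mono[of "{e \<in> E. v \<in> e}" "{{r, v}, {v, x}}"] finE by simp
qed

lemma single_edge: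
  assumes "root_nbrs r E = K" "card K = 1"
  obtains v where "v \<noteq> r" "E = {{r, v}}"
proof -
  obtain v where K: "K = {v}" using assms(2) by (auto simp: card_1_singleton_iff)
  have "inner_edges r E = {}"
  proof (rule ccontr)
    assume "inner_edges r E \<noteq> {}"
    then obtain e where e: "e \<in> E" "r \<notin> e" by (auto simp: inner_edges_def)
    then have "e \<subseteq> {v}" using edgesE K by auto
    then have "card e \<le> 1" using card_mono[of "{v}" e] by simp
    then show False using e pairsE by fastforce
  qed
  then have "E = {{r, v}}" using edges_split[OF pairsE, of r] assms(1) K by simp
  then show thesis using that[of v] K r_notin_K by auto
qed

end

subsection \<open>The order in $x$\<close>

text \<open>The empty set contributes \<open>var_x - 1\<close> and the full set 1.\<close>

lemma rooted_tutte_single_edge: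
  assumes "v \<noteq> r"
  shows "rooted_tutte r {{r, v}} = var_x" "leaves_at r {{r, v}} = {v}"
proof -
  have "reach r {{r, v}} = {r, v}"
    using reach_subset_Union[of r "{{r, v}}"] reach_step[OF root_in_reach[of r "{{r, v}}"], of v]
      root_in_reach[of r "{{r, v}}"] by auto
  then show "rooted_tutte r {{r, v}} = var_x"
    using assms by (simp add: rooted_tutte_def Pow_insert rk_def)
  have "{e \<in> {{r, v}}. v \<in> e} = {{r, v}}" by auto
  then have "card {e \<in> {{r, v}}. v \<in> e} = 1" by simp
  then show "leaves_at r {{r, v}} = {v}"
    using assms by (auto simp: leaves_at_def doubleton_eq_iff)
qed

text \<open>Induction on the number of edges: split off the edges meeting one component of the graph
  without \<open>r\<close>. This factor is x for a root leaf; otherwise it has no root leaf and does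
  not vanish at x = 0.\<close>

lemma rooted_tutte_factor:
  assumes "finite E" "\<forall>e\<in>E. card e = 2"
  shows "\<exists>U. rooted_tutte r E = var_x ^ card (leaves_at r E) * U \<and> poly U 0 \<noteq> 0"
  using assms
proof (induction "card E" arbitrary: E rule: less_induct)
  case less
  note fin = less.prems(1) and pairs = less.prems(2)
  show ?case
  proof (cases "E = {}")
    case True
    then show ?thesis by (auto simp: rooted_tutte_def leaves_at_def rk_def intro!: exI[of _ 1])
  next
    case False
    then obtain e where e: "e \<in> E" by blast
    then obtain v where v: "v \<in> e" "v \<noteq> r" using pairs by (metis card_2_iff insertCI)
    let ?R = "arcs (inner_edges r E)"
    \<comment> \<open>The component of \<open>v\<close> once the root is deleted; \<open>E1\<close>
      below also takes in the root edges ending in it.\<close>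
    define K where "K = ?R\<^sup>* `` {v}"
    define E1 where "E1 = {e \<in> E. e \<inter> K \<noteq> {}}"
    define E2 where "E2 = E - E1"
    have vK: "v \<in> K" by (simp add: K_def)
    have K_step: "w \<in> K" if "u \<in> K" "{u, w} \<in> E" "u \<noteq> r" "w \<noteq> r" for u w
      using that by (auto simp: K_def arcs_def inner_edges_def intro: rtrancl_into_rtrancl)
    have r_notin: "u \<noteq> r" if "u \<in> K" for u
    proof -
      have "(v, u) \<in> ?R\<^sup>*" using that by (simp add: K_def)
      then show ?thesis
        by (induction rule: rtrancl_induct) (use v in \<open>auto simp: arcs_def inner_edges_def\<close>)
    qed
    have E1_sub: "d \<subseteq> insert r K" if d: "d \<in> E1" for d
    proof
      fix w assume w: "w \<in> d"
      obtain u where u: "u \<in> d" "u \<in> K" using d by (auto simp: E1_def)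
      have "u = w \<or> d = {u, w}"
        using w u pairs d by (auto simp: E1_def card_2_iff)
      then show "w \<in> insert r K" using u K_step[of u w] r_notin d by (auto simp: E1_def)
    qed
    have UK: "K \<subseteq> \<Union>E"
    proof
      fix u assume "u \<in> K"
      then have "(v, u) \<in> ?R\<^sup>*" by (simp add: K_def)
      then show "u \<in> \<Union>E"
        by (induction rule: rtrancl_induct) (use e v in \<open>auto simp: arcs_def inner_edges_def\<close>)
    qed
    \<comment> \<open>The locale asks for connectivity by edges of \<open>E1\<close>, whereas
      \<open>K\<close> is defined by edges of \<open>E\<close>; a path from \<open>v\<close> stays
      in \<open>K\<close>, so its edges are in \<open>E1\<close>.\<close>
    have from_v: "(v, u) \<in> (arcs (inner_edges r E1))\<^sup>*" if "u \<in> K" for u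
    proof -
      have "(v, u) \<in> ?R\<^sup>*" using that by (simp add: K_def)
      then show ?thesis
      proof (induction rule: rtrancl_induct)
        case (step y z)
        have "y \<in> K" using step.hyps(1) by (simp add: K_def)
        then have "(y, z) \<in> arcs (inner_edges r E1)"
          using step.hyps(2) by (auto simp: arcs_def inner_edges_def E1_def)
        then show ?case using step.IH by (rule rtrancl_into_rtrancl[rotated])
      qed simp
    qed
    interpret rooted_block r E1 K
    proof
      show "finite E1" "\<forall>e\<in>E1. card e = 2" using fin pairs by (auto simp: E1_def)
      show "finite K" using UK finite_pairs[OF fin pairs] by (rule finite_subset)
      show "K \<noteq> {}" "r \<notin> K" using vK r_notin by auto
      show "\<forall>e\<in>E1. e \<subseteq> insert r K" using E1_sub by blast
      show "(u, w) \<in> (arcs (inner_edges r E1))\<^sup>*" if "u \<in> K" "w \<in> K" for u w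
        using arcs_rtrancl_sym[OF from_v[OF that(1)]] from_v[OF that(2)] by (rule rtrancl_trans)
    qed
    have E: "E = E1 \<union> E2" by (auto simp: E1_def E2_def)
    \<comment> \<open>Edges in \<open>E1\<close> have their ends in \<open>K\<close> or at
      \<open>r\<close>, while edges in \<open>E2\<close> avoid \<open>K\<close>.\<close>
    have sep: "\<Union>E1 \<inter> \<Union>E2 \<subseteq> {r}"
      using E1_sub by (auto simp: E1_def E2_def)
    have fin2: "finite E2" and pairs2: "\<forall>e\<in>E2. card e = 2" using fin pairs by (auto simp: E2_def)
    have "e \<in> E1" using e v vK by (auto simp: E1_def)
    then have "card E2 < card E" using e fin by (intro psubset_card_mono) (auto simp: E2_def)
    then obtain U2 where U2: "rooted_tutte r E2 = var_x ^ card (leaves_at r E2) * U2" "poly U2 0 \<noteq> 0"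
      using less.hyps fin2 pairs2 by blast
    have "\<exists>U1. rooted_tutte r E1 = var_x ^ card (leaves_at r E1) * U1 \<and> poly U1 0 \<noteq> 0"
    proof (cases "root_nbrs r E1 = K \<and> card K = 1")
      case True
      then obtain w where "w \<noteq> r" "E1 = {{r, w}}" using single_edge by metis
      then show ?thesis by (auto simp: rooted_tutte_single_edge intro!: exI[of _ 1])
    next
      case False
      then show ?thesis using poly_nonzero no_leaves by auto
    qed
    then obtain U1 where U1: "rooted_tutte r E1 = var_x ^ card (leaves_at r E1) * U1" "poly U1 0 \<noteq> 0"
      by blast
    have "card (leaves_at r E) = card (leaves_at r E1) + card (leaves_at r E2)"
      unfolding E leaves_at_Un(1)[OF sep]
      by (intro card_Un_disjoint finite_leaves_at leaves_at_Un(2)[OF sep] finE pairsE fin2 pairs2)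
    moreover have "rooted_tutte r E = rooted_tutte r E1 * rooted_tutte r E2"
      unfolding E using pairs E by (intro rooted_tutte_Un sep finE fin2) blast
    \<comment> \<open>The value of \<open>U1 * U2\<close> at 0 is nonzero because integer
      polynomials have no zero divisors.\<close>
    ultimately show ?thesis
      using U1 U2 by (intro exI[of _ "U1 * U2"]) (simp add: power_add mult_ac)
  qed
qed

text \<open>After cancelling \<open>var_x ^ l\<close>, a higher power would make
  \<open>var_x\<close> divide \<open>U\<close>, and then \<open>U\<close> would vanish at 0.\<close>

lemma ord_x_eqI:
  assumes "p = var_x ^ l * U" "poly U 0 \<noteq> 0"
  shows "ord_x p = l"
proof -
  have x: "var_x \<noteq> 0" by (simp add: var_x_def)
  have "a \<le> l" if "var_x ^ a dvd p" for a
  proof (rule ccontr)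
    assume "\<not> a \<le> l"
    then have "var_x ^ Suc l dvd var_x ^ l * U"
      using that assms(1) by (metis not_less_eq_eq power_le_dvd)
    then have "var_x dvd U" using x by simp
    then show False using assms(2) by (auto simp: var_x_def dvd_def)
  qed
  then have "{a. var_x ^ a dvd p} = {..l}"
    using assms(1) by (auto intro: dvd_mult2 le_imp_power_dvd)
  then show ?thesis unfolding ord_x_def by (auto intro: Max_eqI)
qed

theorem theorem1p4:
  fixes G :: "'v rooted_graph"
  assumes "simple_rooted_graph G"
  shows "ord_x (greedoid_tutte (graph_greedoid G)) = num_root_leaves G"
proof -
  note E = simple_rooted_graph_edges[OF assms]
  have T: "greedoid_tutte (graph_greedoid G) = rooted_tutte (rootv G) (edges G)"
    unfolding greedoid_tutte_def rooted_tutte_def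
    using greedoid_rank_eq_rk[OF assms] by (intro sum.cong) (auto simp: graph_greedoid_def)
  \<comment> \<open>Edges have their ends in \<open>verts G\<close>, so the vertex condition in
    \<open>root_leaves\<close> is automatic.\<close>
  have "root_leaves G = leaves_at (rootv G) (edges G)"
    using E(3) by (auto simp: root_leaves_def leaves_at_def graph_deg_def)
  then show ?thesis
    using rooted_tutte_factor[OF E(1,2), of "rootv G"] ord_x_eqI
    by (auto simp: T num_root_leaves_def)
qed

end
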